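(* Let $k \geq 2$ and $g \geq 1$ be integers. Then $$N(k,g-1,2) \geq \binom{g-1}{1+\lfloor k/2 \rfloor}.$$
   Context: $S_{g,p}$ denotes the compact orientable surface of genus $g$ with $p$ boundary components. A simple closed curve on $S_{g,p}$ is essential if it is homotopically non-trivial and not homotopic to a boundary component. A $k$-system on $S_{g,p}$ is a collection of essential, pairwise non-homotopic simple closed curves on $S_{g,p}$ such that no two curves in the collection intersect more than $k$ times; here intersections are counted by the geometric intersection number $i(\alpha,\beta)$, the minimum of $|x \cap y|$ over all $x$ homotopic to $\alpha$ and $y$ homotopic to $\beta$. $N(k,g,p)$ denotes the maximum cardinality of a $k$-system on $S_{g,p}$. The binomial coefficient $\binom{a}{b}$ is $0$ when $b > a$. *)

theory Defs
  imports "HOL-Analysis.Analysis"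
begin

section \<open>The compact orientable surface of genus g with p boundary components\<close>

text \<open>
  A concrete model in 3-space. A rectangular slab with g disjoint round holes drilled through it
  is a handlebody of genus g, so its frontier is the closed orientable surface of genus g. From
  the top face of this surface, p disjoint open round discs are removed. All holes and discs
  have radius 1/2; their centres are 0, 2, 4, ..., the first g being used for the drilled holes and
  the next p for the removed discs.
\<close>

definition centre :: "nat \<Rightarrow> complex" where
  "centre i = 2 * of_nat i"

definition handlebody :: "nat \<Rightarrow> nat \<Rightarrow> (complex \<times> real) set" where
  "handlebody g p =
     (cbox (Complex (-2) (-2)) (Complex (2 * real (g + p)) 2) - (\<Union>i<g. ball (centre i) (1/2)))
       \<times> {0..1}"

definition surface :: "nat \<Rightarrow> nat \<Rightarrow> (complex \<times> real) set" where
  "surface g p =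
     frontier (handlebody g p) - (\<Union>j<p. ball (centre (g + j)) (1/2) \<times> {1})"

definition boundary_curve :: "nat \<Rightarrow> nat \<Rightarrow> real \<Rightarrow> complex \<times> real" where
  "boundary_curve g j = (\<lambda>t. (centre (g + j) + cis (2 * pi * t) / 2, 1))"

section \<open>Simple closed curves\<close>

definition simple_closed_curve :: "'a::topological_space set \<Rightarrow> (real \<Rightarrow> 'a) \<Rightarrow> bool" where
  "simple_closed_curve S c \<longleftrightarrow>
     simple_path c \<and> pathfinish c = pathstart c \<and> path_image c \<subseteq> S"

text \<open>
  Curves are unoriented and carry no base point: homotopy is free homotopy of closed curves, up to
  reversal of direction. In particular, two parametrizations of the same curve are homotopic.
\<close>

definition homotopic_curves ::
    "'a::topological_space set \<Rightarrow> (real \<Rightarrow> 'a) \<Rightarrow> (real \<Rightarrow> 'a) \<Rightarrow> bool" where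
  "homotopic_curves S a b \<longleftrightarrow> homotopic_loops S a b \<or> homotopic_loops S a (reversepath b)"

definition essential :: "nat \<Rightarrow> nat \<Rightarrow> (real \<Rightarrow> complex \<times> real) \<Rightarrow> bool" where
  "essential g p c \<longleftrightarrow>
     (\<nexists>x. homotopic_loops (surface g p) c (\<lambda>t. x)) \<and>
     (\<forall>j<p. \<not> homotopic_curves (surface g p) c (boundary_curve g j))"

definition ecard :: "'a set \<Rightarrow> enat" where
  "ecard A = (if finite A then enat (card A) else \<infinity>)"

text \<open>
  The representatives are simple closed curves, so that counting points of the intersection of the
  images is the right count: a closed curve with self-intersections could pass several times
  through one intersection point. As enat is well-ordered, the infimum is a minimum.
\<close>

definition geometric_intersection ::
    "'a::topological_space set \<Rightarrow> (real \<Rightarrow> 'a) \<Rightarrow> (real \<Rightarrow> 'a) \<Rightarrow> enat" where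
  "geometric_intersection S a b =
     Inf {ecard (path_image x \<inter> path_image y) | x y.
            simple_closed_curve S x \<and> homotopic_curves S x a \<and>
            simple_closed_curve S y \<and> homotopic_curves S y b}"

section \<open>Systems of curves\<close>

definition curve_system :: "nat \<Rightarrow> nat \<Rightarrow> nat \<Rightarrow> (real \<Rightarrow> complex \<times> real) set \<Rightarrow> bool" where
  "curve_system k g p C \<longleftrightarrow>
     (\<forall>a\<in>C. simple_closed_curve (surface g p) a \<and> essential g p a) \<and>
     (\<forall>a\<in>C. \<forall>b\<in>C. a \<noteq> b \<longrightarrow>
        \<not> homotopic_curves (surface g p) a b \<and>
        geometric_intersection (surface g p) a b \<le> enat k)"

text \<open>
  The supremum is taken in enat, so that the definition does not presuppose that the cardinalities
  are bounded; when they are, it is the maximum.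
\<close>

definition max_curve_system :: "nat \<Rightarrow> nat \<Rightarrow> nat \<Rightarrow> enat" where
  "max_curve_system k g p = Sup {ecard C | C. curve_system k g p C}"

end

(*
  The top face of the surface is a box in the plane containing the drilled holes, and the projection
  of the whole surface to the plane misses the centres of the drilled holes. Hence the winding
  numbers of the projected curve around these centres are invariants of free homotopy, and a curve
  with a nonzero one is essential.

  For an m-subset A of the n = g - 1 holes, where m = 1 + k div 2, let p_A be the polynomial of
  degree m with leading coefficient 2^m and simple roots at the points 2a + 1 (a in A) of the gaps
  to the right of the holes. The curve of A consists of the graph of arctan o p_A and a U-shaped
  polygon below it; it surrounds the holes i with p_A(2i) > 0, and these determine A. The U-shaped
  parts are nested, hence disjoint. So two curves meet at most in the common points of the graphs, of
  which there are fewer than m because p_A - p_B has degree < m, and at the two vertical sides of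
  the inner curve. This gives at most m + 1 <= 2(m - 1) <= k points if m >= 3. If m = 2, then
  p_A - p_B is affine and the three possible points cannot occur together.
*)

theory Submission
  imports Defs "HOL-Complex_Analysis.Winding_Numbers"
begin

section \<open>Loops formed by a graph and three sides of a rectangle\<close>

definition graph_arc :: "real \<Rightarrow> real \<Rightarrow> (real \<Rightarrow> real) \<Rightarrow> real \<Rightarrow> complex" where
  "graph_arc a b f = (\<lambda>t. Complex (linepath a b t) (f (linepath a b t)))"

text \<open>Counterclockwise from the lower left corner, in the order of \<open>rectpath\<close>;
  hence the graph is run from right to left.\<close>

definition graph_loop :: "real \<Rightarrow> real \<Rightarrow> real \<Rightarrow> (real \<Rightarrow> real) \<Rightarrow> real \<Rightarrow> complex" where
  "graph_loop l r b f =
     linepath (Complex l b) (Complex r b) +++ linepath (Complex r b) (Complex r (f r)) +++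
     graph_arc r l f +++ linepath (Complex l (f l)) (Complex l b)"

lemma pathstart_graph_arc [simp]: "pathstart (graph_arc a b f) = Complex a (f a)"
  and pathfinish_graph_arc [simp]: "pathfinish (graph_arc a b f) = Complex b (f b)"
  by (simp_all add: graph_arc_def pathstart_def pathfinish_def linepath_def)

lemma linepath_image_real: "linepath a b ` {0..1} = closed_segment a (b :: real)"
  using path_image_linepath[of a b] by (simp add: path_image_def)

lemma path_graph_arc:
  assumes "continuous_on (closed_segment a b) f"
  shows "path (graph_arc a b f)"
proof -
  have "continuous_on {0..1} (f \<circ> linepath a b)"
    using assms by (intro continuous_on_compose continuous_on_linepath) (simp add: linepath_image_real)
  then have "continuous_on {0..1} (\<lambda>t. f (linepath a b t))"
    by (simp add: o_def)
  then show ?thesis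
    unfolding path_def graph_arc_def Complex_eq
    by (intro continuous_intros continuous_on_linepath)
qed

lemma arc_graph_arc:
  assumes "continuous_on (closed_segment a b) f" "a \<noteq> b"
  shows "arc (graph_arc a b f)"
proof -
  have "inj_on (linepath a b) {0..1}"
    using arc_linepath[OF assms(2)] by (simp add: arc_def)
  then have "inj_on (graph_arc a b f) {0..1}"
    by (auto simp: inj_on_def graph_arc_def)
  with path_graph_arc[OF assms(1)] show ?thesis
    by (simp add: arc_def)
qed

lemma path_image_graph_arc:
  "path_image (graph_arc a b f) = {z. Re z \<in> closed_segment a b \<and> Im z = f (Re z)}"
  unfolding path_image_def graph_arc_def linepath_image_real[symmetric]
  by (force simp: image_iff complex_eq_iff)

context
  fixes l r b :: real and f :: "real \<Rightarrow> real"
  assumes lr: "l < r"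
    and cont: "continuous_on {l..r} f"
    and above: "\<And>x. x \<in> {l..r} \<Longrightarrow> b < f x"
begin

lemma continuous_on_graph_segment: "continuous_on (closed_segment r l) f"
  using cont lr by (simp add: closed_segment_eq_real_ivl)

lemma path_image_graph_loop:
  "path_image (graph_loop l r b f) =
     {z. Im z = b \<and> Re z \<in> {l..r}} \<union> {z. Re z = r \<and> Im z \<in> {b..f r}} \<union>
     {z. Re z \<in> {l..r} \<and> Im z = f (Re z)} \<union> {z. Re z = l \<and> Im z \<in> {b..f l}}"
  using lr above[of l] above[of r] unfolding graph_loop_def
  by (auto simp: path_image_join path_image_graph_arc closed_segment_same_Re closed_segment_same_Im
      closed_segment_eq_real_ivl)

lemma simple_path_graph_loop: "simple_path (graph_loop l r b f)"
  using lr above[of l] above[of r] above arc_graph_arc[OF continuous_on_graph_segment]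
  unfolding graph_loop_def
  by (intro simple_path_join_loop arc_join arc_linepath)
     (force simp: complex_eq_iff path_image_join path_image_graph_arc closed_segment_same_Re
        closed_segment_same_Im closed_segment_eq_real_ivl)+

end

lemma loop_graph_loop: "pathfinish (graph_loop l r b f) = pathstart (graph_loop l r b f)"
  by (simp add: graph_loop_def)

text \<open>Rectangles are the reference loops: their winding numbers are known, and deforming the
  top side carries these over to a general graph.\<close>

lemma graph_loop_const: "graph_loop l r b (\<lambda>_. h) = rectpath (Complex l b) (Complex r h)"
proof -
  have "graph_arc r l (\<lambda>_. h) = linepath (Complex r h) (Complex l h)"
    by (simp add: fun_eq_iff graph_arc_def linepath_def complex_eq_iff algebra_simps)
  then show ?thesis
    by (simp add: graph_loop_def rectpath_def Let_def)
qed

text \<open>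
  At each parameter the loops over two graphs have the same real part, so that the straight-line
  homotopy between them moves vertically.
\<close>

lemma graph_loop_segment:
  assumes "l < r" "t \<in> {0..1}" "w \<in> closed_segment (graph_loop l r b f t) (graph_loop l r b h t)"
  shows "Im w = b \<or> Re w = l \<or> Re w = r \<or>
    Re w \<in> {l..r} \<and> Im w \<in> closed_segment (f (Re w)) (h (Re w))"
proof -
  let ?F = "graph_loop l r b f t" and ?H = "graph_loop l r b h t"
  have "?F = ?H \<and> Im ?F = b \<or> Re ?F = l \<and> Re ?H = l \<or> Re ?F = r \<and> Re ?H = r \<or>
    (\<exists>x\<in>{l..r}. ?F = Complex x (f x) \<and> ?H = Complex x (h x))"
  proof -
    consider (1) "t \<le> 1/2" | (2) "\<not> t \<le> 1/2" "2*t-1 \<le> 1/2"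
      | (3) "\<not> t \<le> 1/2" "\<not> 2*t-1 \<le> 1/2" "2*(2*t-1)-1 \<le> 1/2"
      | (4) "\<not> t \<le> 1/2" "\<not> 2*t-1 \<le> 1/2" "\<not> 2*(2*t-1)-1 \<le> 1/2"
      by blast
    then show ?thesis
    proof cases
      case 1
      then show ?thesis
        by (simp add: graph_loop_def joinpaths_def linepath_def algebra_simps)
    next
      case 2
      then show ?thesis
        by (simp add: graph_loop_def joinpaths_def linepath_def algebra_simps)
    next
      case 3
      define s where "s = 2 * (2*(2*t-1)-1)"
      have s: "s \<in> {0..1}"
        using 3 by (auto simp: s_def)
      have "linepath r l s \<in> closed_segment r l"
        using s linepath_image_real[of r l] by blast
      then have "linepath r l s \<in> {l..r}"
        using assms(1) by (simp add: closed_segment_eq_real_ivl)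
      moreover have "?F = graph_arc r l f s" "?H = graph_arc r l h s"
        using 3 unfolding graph_loop_def joinpaths_def s_def by simp_all
      ultimately show ?thesis
        by (auto simp: graph_arc_def)
    next
      case 4
      then show ?thesis
        by (simp add: graph_loop_def joinpaths_def linepath_def algebra_simps)
    qed
  qed
  then consider "?F = ?H" "Im ?F = b" | "Re ?F = l" "Re ?H = l" | "Re ?F = r" "Re ?H = r"
    | x where "x \<in> {l..r}" "?F = Complex x (f x)" "?H = Complex x (h x)"
    by blast
  then show ?thesis
    using assms(3) by cases (simp_all add: closed_segment_same_Re)
qed

section \<open>Winding numbers of graph loops\<close>

lemma winding_number_graph_loop_cong:
  assumes "l < r" "continuous_on {l..r} f" "continuous_on {l..r} h" "b < Im z" "l < Re z" "Re z < r"
    and "Im z \<notin> closed_segment (f (Re z)) (h (Re z))"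
    and "\<And>x. x \<in> {l..r} \<Longrightarrow> b < f x" "\<And>x. x \<in> {l..r} \<Longrightarrow> b < h x"
  shows "winding_number (graph_loop l r b f) z = winding_number (graph_loop l r b h) z"
proof (intro winding_number_homotopic_loops homotopic_loops_linear loop_graph_loop)
  show "path (graph_loop l r b f)" "path (graph_loop l r b h)"
    using assms by (auto intro!: simple_path_imp_path simple_path_graph_loop)
  \<comment> \<open>\<open>z\<close> is off the bottom and the vertical lines, and by the condition
    on \<open>Im z\<close> it is not between the two graphs.\<close>
  show "closed_segment (graph_loop l r b f t) (graph_loop l r b h t) \<subseteq> - {z}" if "t \<in> {0..1}" for t
    using graph_loop_segment[OF assms(1) that, of z b f h] assms(4-7) by auto
qed

text \<open>The graph can be deformed to a horizontal line without crossing \<open>z\<close>: if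
  \<open>z\<close> is below the graph, to a line one unit above \<open>z\<close>; otherwise to the
  line halfway between the bottom and \<open>z\<close>.\<close>

lemma winding_number_graph_loop:
  assumes "l < r" "continuous_on {l..r} f" "b < Im z" "l < Re z" "Re z < r" "Im z \<noteq> f (Re z)"
    and "\<And>x. x \<in> {l..r} \<Longrightarrow> b < f x"
  shows "winding_number (graph_loop l r b f) z = (if Im z < f (Re z) then 1 else 0)"
proof (cases "Im z < f (Re z)")
  case True
  have "winding_number (graph_loop l r b f) z = winding_number (graph_loop l r b (\<lambda>_. Im z + 1)) z"
    using assms True by (intro winding_number_graph_loop_cong) (auto simp: closed_segment_eq_real_ivl)
  also have "\<dots> = 1"
    using assms by (simp add: graph_loop_const winding_number_rectpath in_box_complex_iff)
  finally show ?thesis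
    using True by simp
next
  case False
  have "winding_number (graph_loop l r b f) z = winding_number (graph_loop l r b (\<lambda>_. (b + Im z) / 2)) z"
    using assms False by (intro winding_number_graph_loop_cong) (auto simp: closed_segment_eq_real_ivl)
  also have "\<dots> = 0"
    using assms
    by (subst graph_loop_const) (rule winding_number_rectpath_outside, auto simp: in_cbox_complex_iff)
  finally show ?thesis
    using False by simp
qed

section \<open>Polynomials with a root in each of a set of gaps\<close>

text \<open>The factor for \<open>a\<close> is \<open>2 * (x - (2 * a + 1))\<close>, with its root
  midway between the centres of the holes \<open>a\<close> and \<open>a + 1\<close>. The scaling by
  2 serves the lower bound 1 over the holes.\<close>

definition gap_poly :: "nat set \<Rightarrow> real poly" where
  "gap_poly A = (\<Prod>a\<in>A. [:- (4 * real a + 2), 2:])"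

lemma poly_gap_poly: "poly (gap_poly A) x = (\<Prod>a\<in>A. 2 * x - (4 * real a + 2))"
  by (simp add: gap_poly_def poly_prod algebra_simps)

lemma degree_gap_poly: "degree (gap_poly A) = card A"
  unfolding gap_poly_def by (subst degree_prod_eq_sum_degree) auto

lemma lead_coeff_gap_poly: "lead_coeff (gap_poly A) = 2 ^ card A"
  unfolding gap_poly_def by (simp add: lead_coeff_prod)

text \<open>The roots are odd integers, so they are at distance at least 1/2 from any such
  \<open>x\<close>. The bound later keeps the graph clear of the holes.\<close>

lemma abs_poly_gap_poly_ge_1:
  assumes "\<bar>x - 2 * real i\<bar> \<le> 1/2"
  shows "1 \<le> \<bar>poly (gap_poly A) x\<bar>"
proof -
  have "1 \<le> \<bar>2 * x - (4 * real a + 2)\<bar>" for a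
  proof (cases "i \<le> a")
    case True
    then have "real i \<le> real a"
      by simp
    then show ?thesis
      using assms by linarith
  next
    case False
    then have "real a + 1 \<le> real i"
      by linarith
    then show ?thesis
      using assms by linarith
  qed
  then show ?thesis
    unfolding poly_gap_poly abs_prod by (intro prod_ge_1) auto
qed

text \<open>The factor for \<open>i\<close> takes the values -2 and 2 at the two centres; every
  other factor has the same sign at both. So the sign pattern records \<open>A\<close>.\<close>

lemma gap_poly_sign_change:
  assumes "finite A"
  shows "poly (gap_poly A) (2 * real i) * poly (gap_poly A) (2 * real (Suc i)) < 0 \<longleftrightarrow> i \<in> A"
proof -
  let ?q = "\<lambda>a. (2 * (2 * real i) - (4 * real a + 2)) * (2 * (2 * real (Suc i)) - (4 * real a + 2))"
  have pos: "0 < ?q a" if "a \<noteq> i" for a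
  proof (cases "a < i")
    case True
    then have "real a + 1 \<le> real i"
      by linarith
    then show ?thesis
      by (intro mult_pos_pos) auto
  next
    case False
    then have "real i + 1 \<le> real a"
      using that by linarith
    then show ?thesis
      by (intro mult_neg_neg) auto
  qed
  have eq: "poly (gap_poly A) (2 * real i) * poly (gap_poly A) (2 * real (Suc i)) = prod ?q A"
    unfolding poly_gap_poly prod.distrib ..
  show ?thesis
  proof (cases "i \<in> A")
    case True
    have "0 < prod ?q (A - {i})"
      using pos by (intro prod_pos) auto
    then show ?thesis
      unfolding eq using True assms by (simp add: prod.remove mult_less_0_iff)
  next
    case False
    have "0 < prod ?q A"
      using False by (intro prod_pos pos) auto
    then show ?thesis
      unfolding eq using False by simp
  qed
qed

text \<open>This place is to the right of all roots. It is no drilled hole, so no winding number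
  shows the sign there, yet the sign is needed to decide whether the last gap belongs to
  \<open>A\<close>.\<close>

lemma gap_poly_pos:
  assumes "A \<subseteq> {..<n}"
  shows "0 < poly (gap_poly A) (2 * real n)"
proof -
  have "0 < 2 * (2 * real n) - (4 * real a + 2)" if "a \<in> A" for a
  proof -
    have "real a + 1 \<le> real n"
      using that assms by force
    then show ?thesis
      by simp
  qed
  then show ?thesis
    unfolding poly_gap_poly by (intro prod_pos) auto
qed

lemma gap_poly_pos_somewhere:
  assumes "A \<subseteq> {..<n}" "2 \<le> card A"
  obtains i where "i < n" "0 < poly (gap_poly A) (2 * real i)"
proof -
  have "finite A"
    using assms(1) finite_subset by blast
  \<comment> \<open>The last gap has no drilled hole on its right; a gap between two holes is
    wanted.\<close>
  have "\<not> A \<subseteq> {n - 1}"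
    using assms(2) card_mono[of "{n - 1}" A] by auto
  then obtain a where a: "a \<in> A" "Suc a < n"
    using assms(1) by fastforce
  then have "poly (gap_poly A) (2 * real a) * poly (gap_poly A) (2 * real (Suc a)) < 0"
    using gap_poly_sign_change[OF \<open>finite A\<close>] by blast
  then have "0 < poly (gap_poly A) (2 * real a) \<or> 0 < poly (gap_poly A) (2 * real (Suc a))"
    unfolding mult_less_0_iff by blast
  then show ?thesis
    using that[of a] that[of "Suc a"] a(2) by linarith
qed

lemma gap_poly_signs_inj:
  assumes "A \<subseteq> {..<n}" "B \<subseteq> {..<n}"
    and "\<And>i. i < n \<Longrightarrow> 0 < poly (gap_poly A) (2 * real i) \<longleftrightarrow> 0 < poly (gap_poly B) (2 * real i)"
  shows "A = B"
proof -
  have fin: "finite A" "finite B"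
    using assms(1,2) finite_subset by blast+
  \<comment> \<open>Without zeros, failing to be positive means being negative, so positivity alone
    determines the sign changes.\<close>
  have nz: "poly (gap_poly C) (2 * real i) \<noteq> 0" for C i
    using abs_poly_gap_poly_ge_1[of "2 * real i" i C] by auto
  have signs: "0 < poly (gap_poly A) (2 * real i) \<longleftrightarrow> 0 < poly (gap_poly B) (2 * real i)" if "i \<le> n" for i
    using assms that gap_poly_pos by (cases "i = n") auto
  have "i \<in> A \<longleftrightarrow> i \<in> B" if "i < n" for i
    unfolding gap_poly_sign_change[OF fin(1), symmetric] gap_poly_sign_change[OF fin(2), symmetric]
    using signs[of i] signs[of "Suc i"] nz that
    by (smt (verit) Suc_leI less_imp_le mult_less_0_iff)
  then show ?thesis
    using assms(1,2) by blast
qed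

lemma card_gap_poly_agree:
  assumes "finite A" "A \<noteq> B" "card A = m" "card B = m" "finite B"
  defines "Z \<equiv> {x. poly (gap_poly A) x = poly (gap_poly B) x}"
  shows "finite Z" "card Z < m"
proof -
  have ne: "gap_poly A \<noteq> gap_poly B"
    using gap_poly_sign_change assms by (metis subsetI subset_antisym)
  have "Z = {x. poly (gap_poly A - gap_poly B) x = 0}"
    by (simp add: Z_def)
  with ne show "finite Z"
    using poly_roots_finite[of "gap_poly A - gap_poly B"] by simp
  show "card Z < m"
  proof (rule ccontr)
    assume "\<not> card Z < m"
    \<comment> \<open>Both polynomials have degree \<open>m\<close> and leading coefficient
      \<open>2 ^ m\<close>, so agreement at \<open>m\<close> points would make them equal.\<close>
    then have "gap_poly A = gap_poly B"
      using assms lead_coeff_gap_poly[of A] lead_coeff_gap_poly[of B]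
      by (intro poly_eqI_degree_lead_coeff[of _ m _ Z]) (auto simp: degree_gap_poly Z_def)
    with ne show False ..
  qed
qed

text \<open>
  Two quadratics with the same leading coefficient differ by an affine function, which has no
  interior zero on an interval if it is nonnegative at both ends.
\<close>

lemma gap_poly_agree_ends:
  assumes "finite A" "finite B" "A \<noteq> B" "card A = 2" "card B = 2"
    and "l < r" "x \<in> {l..r}" "poly (gap_poly A) x = poly (gap_poly B) x"
    and "poly (gap_poly B) l \<le> poly (gap_poly A) l" "poly (gap_poly B) r \<le> poly (gap_poly A) r"
  shows "x = l \<or> x = r"
proof (rule ccontr)
  assume "\<not> ?thesis"
  then have x: "l < x" "x < r"
    using assms(7) by auto
  define d where "d = gap_poly A - gap_poly B"
  have "coeff d k = 0" if "1 < k" for k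
  proof (cases "k = 2")
    case True
    then show ?thesis
      using assms lead_coeff_gap_poly[of A] lead_coeff_gap_poly[of B] by (simp add: d_def degree_gap_poly)
  next
    case False
    then show ?thesis
      using assms that by (simp add: d_def coeff_eq_0 degree_gap_poly)
  qed
  then have "d = [:coeff d 0, coeff d 1:]"
    by (auto simp: poly_eq_iff coeff_pCons split: nat.split)
  then obtain u v where "d = [:u, v:]"
    by blast
  then have d: "poly d y = u + v * y" for y
    by simp
  have "0 \<le> poly d l" "0 \<le> poly d r" "poly d x = 0"
    using assms by (simp_all add: d_def)
  \<comment> \<open>As \<open>u + v * x = 0\<close>, these are the values of \<open>d\<close> at the
    ends; \<open>l - x\<close> and \<open>r - x\<close> have opposite signs.\<close>
  then have "0 \<le> v * (l - x)" "0 \<le> v * (r - x)"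
    by (simp_all add: d algebra_simps)
  then have "v = 0"
    using x by (simp add: zero_le_mult_iff)
  then have "u = 0"
    using \<open>poly d x = 0\<close> d by simp
  then have "gap_poly A = gap_poly B"
    using \<open>d = [:u, v:]\<close> \<open>v = 0\<close> by (simp add: d_def)
  then show False
    using gap_poly_sign_change assms by (metis subsetI subset_antisym)
qed

section \<open>Winding numbers of curves on the surface\<close>

lemma Re_centre [simp]: "Re (centre i) = 2 * real i" and Im_centre [simp]: "Im (centre i) = 0"
  by (simp_all add: centre_def)

lemma top_face_in_surface:
  assumes "z \<in> cbox (Complex (-2) (-2)) (Complex (2 * real (g + p)) 2)"
    and "\<And>i. i < g + p \<Longrightarrow> 1/2 \<le> dist (centre i) z"
  shows "(z, 1) \<in> surface g p"
proof -
  have not_ball: "z \<notin> ball (centre i) (1/2)" if "i < g + p" for i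
    using assms(2)[OF that] by simp
  have "(z, 1) \<in> handlebody g p"
    using assms(1) not_ball by (auto simp: handlebody_def)
  moreover have "(z, 1) \<notin> interior (handlebody g p)"
    by (simp add: handlebody_def interior_Times)
  ultimately have "(z, 1) \<in> frontier (handlebody g p)"
    unfolding frontier_def using closure_subset by blast
  then show ?thesis
    unfolding surface_def using not_ball by auto
qed

text \<open>The handlebody is closed, so it contains its frontier, and it has no point over the
  centre of a drilled hole. Thus the projection maps the surface into the plane punctured at these
  centres.\<close>

lemma fst_surface_neq_centre:
  assumes "x \<in> surface g p" "i < g"
  shows "fst x \<noteq> centre i"
proof -
  have "closed (handlebody g p)"
    unfolding handlebody_def by (intro closed_Times closed_Diff closed_cbox open_UN) auto
  then have "x \<in> handlebody g p"
    using assms(1) by (auto simp: surface_def frontier_def)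
  then show ?thesis
    using assms(2) by (auto simp: handlebody_def)
qed

lemma winding_number_fst_homotopic_loops:
  assumes "homotopic_loops (surface g p) a b" "i < g"
  shows "winding_number (fst \<circ> a) (centre i) = winding_number (fst \<circ> b) (centre i)"
  using assms(2)
  by (intro winding_number_homotopic_loops homotopic_loops_continuous_image[OF assms(1)])
     (auto intro!: continuous_intros dest: fst_surface_neq_centre)

text \<open>Reversal changes the sign of the winding number; its vanishing is what unoriented curves
  retain.\<close>

lemma winding_number_fst_homotopic_curves:
  assumes "homotopic_curves (surface g p) a b" "i < g"
  shows "winding_number (fst \<circ> a) (centre i) = 0 \<longleftrightarrow> winding_number (fst \<circ> b) (centre i) = 0"
  using assms(1) unfolding homotopic_curves_def
proof
  assume "homotopic_loops (surface g p) a b"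
  then show ?thesis
    using winding_number_fst_homotopic_loops assms(2) by metis
next
  assume rev: "homotopic_loops (surface g p) a (reversepath b)"
  then have b: "path b" "path_image b \<subseteq> surface g p"
    using homotopic_loops_imp_path homotopic_loops_imp_subset by fastforce+
  have "fst \<circ> reversepath b = reversepath (fst \<circ> b)"
    by (auto simp: reversepath_def)
  moreover have "path (fst \<circ> b)"
    using b(1) by (intro path_continuous_image continuous_intros)
  moreover have "centre i \<notin> path_image (fst \<circ> b)"
    using b(2) assms(2) by (auto simp: path_image_compose dest!: fst_surface_neq_centre)
  ultimately show ?thesis
    using winding_number_fst_homotopic_loops[OF rev assms(2)] by (simp add: winding_number_reversepath)
qed

text \<open>Constant loops do not wind around a drilled hole, nor do the boundary circles, which
  project into closed discs that miss its centre.\<close>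

lemma essentialI:
  assumes "i < g" "winding_number (fst \<circ> c) (centre i) \<noteq> 0"
  shows "essential g p c"
  unfolding essential_def
proof (intro conjI allI impI notI)
  assume "\<exists>x. homotopic_loops (surface g p) c (\<lambda>t. x)"
  then obtain x where x: "homotopic_loops (surface g p) c (\<lambda>t. x)"
    by blast
  then have "x \<in> surface g p"
    using homotopic_loops_imp_subset[OF x] by (auto simp: path_image_def)
  then have "winding_number (linepath (fst x) (fst x)) (centre i) = 0"
    using assms(1) by (intro winding_number_trivial) (auto dest: fst_surface_neq_centre)
  moreover have "linepath (fst x) (fst x) = fst \<circ> (\<lambda>t. x)"
    by (auto simp: linepath_def algebra_simps simp flip: scaleR_add_left)
  ultimately show False
    using winding_number_fst_homotopic_loops[OF x assms(1)] assms(2) by simp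
next
  fix j
  assume c: "homotopic_curves (surface g p) c (boundary_curve g j)"
  let ?d = "fst \<circ> boundary_curve g j"
  have d: "?d = (\<lambda>t. centre (g + j) + cis (2 * pi * t) / 2)"
    by (auto simp: boundary_curve_def)
  have "winding_number ?d (centre i) = 0"
  proof (rule winding_number_zero_outside)
    show "path ?d"
      unfolding d path_def cis_conv_exp by (intro continuous_intros) auto
    show "pathfinish ?d = pathstart ?d"
      by (simp add: d pathfinish_def pathstart_def)
    show "path_image ?d \<subseteq> cball (centre (g + j)) (1/2)"
      unfolding d path_image_def by (auto simp: dist_norm norm_divide)
    have "1/2 < 2 * real (g + j) - 2 * real i"
      using assms(1) by simp
    also have "\<dots> \<le> cmod (centre (g + j) - centre i)"
      using complex_Re_le_cmod[of "centre (g + j) - centre i"] by simp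
    finally show "centre i \<notin> cball (centre (g + j)) (1/2)"
      by (simp add: dist_norm)
  qed simp
  then show False
    using winding_number_fst_homotopic_curves[OF c assms(1)] assms(2) by simp
qed

section \<open>The system of curves\<close>

text \<open>Increasing \<open>e\<close> moves the bottom down and the sides outwards, which nests
  the U-shaped parts. For \<open>0 < e < 1/4\<close> the right side stays between the places
  \<open>2n - 2\<close> and \<open>2n\<close>, and the bottom stays in the box.
  \<open>arctan\<close> bounds the graph and, being strictly increasing and odd, preserves order and
  sign.\<close>

definition top_curve :: "nat \<Rightarrow> real \<Rightarrow> nat set \<Rightarrow> real \<Rightarrow> complex" where
  "top_curve n e A =
     graph_loop (-1 - e) (2 * real n - 1 + e) (-7/4 - e) (\<lambda>x. arctan (poly (gap_poly A) x))"

text \<open>The rational bound 7/4 for \<open>pi / 2\<close> leaves a margin of 1/4 above the edge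
  of the box at height -2, where the bottom sides fit.\<close>

lemma abs_arctan_less: "\<bar>arctan x\<bar> < 7/4"
proof -
  have "pi / 2 < 7/4"
    using pi_approx by simp
  with arctan_bounded[of x] have "arctan x < 7/4" "- arctan x < 7/4"
    by linarith+
  then show ?thesis
    by (simp add: abs_less_iff)
qed

text \<open>\<open>arctan 1\<close> is \<open>pi / 4\<close>, which exceeds the radius 1/2 of the
  holes; so the graph passes above or below each of them.\<close>

lemma abs_arctan_ge_half:
  assumes "1 \<le> \<bar>x\<bar>"
  shows "1/2 \<le> \<bar>arctan x\<bar>"
proof -
  have "arctan 1 \<le> arctan \<bar>x\<bar>"
    using assms by (simp only: arctan_le_iff)
  also have "\<dots> \<le> \<bar>arctan x\<bar>"
    by (simp add: abs_if arctan_minus)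
  finally show ?thesis
    using pi_gt3 unfolding arctan_one by linarith
qed

context
  fixes n :: nat and e :: real and A :: "nat set"
  assumes e: "0 < e" "e < 1/4"
begin

lemma top_curve_graph:
  shows "-1 - e < 2 * real n - 1 + e"
    and "continuous_on {-1 - e..2 * real n - 1 + e} (\<lambda>x. arctan (poly (gap_poly A) x))"
    and "-7/4 - e < arctan (poly (gap_poly A) x)"
  using e abs_arctan_less[of "poly (gap_poly A) x"] by (auto intro!: continuous_intros)

lemma simple_path_top_curve: "simple_path (top_curve n e A)"
  unfolding top_curve_def by (intro simple_path_graph_loop top_curve_graph)

lemma path_image_top_curve:
  "path_image (top_curve n e A) =
     {z. Im z = -7/4 - e \<and> Re z \<in> {-1 - e..2 * real n - 1 + e}} \<union>
     {z. Re z = 2 * real n - 1 + e \<and> Im z \<in> {-7/4 - e..arctan (poly (gap_poly A) (2 * real n - 1 + e))}} \<union>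
     {z. Re z \<in> {-1 - e..2 * real n - 1 + e} \<and> Im z = arctan (poly (gap_poly A) (Re z))} \<union>
     {z. Re z = -1 - e \<and> Im z \<in> {-7/4 - e..arctan (poly (gap_poly A) (-1 - e))}}"
  unfolding top_curve_def by (intro path_image_graph_loop top_curve_graph)

lemma simple_closed_curve_top_curve:
  "simple_closed_curve (surface n 2) (\<lambda>t. (top_curve n e A t, 1))"
  unfolding simple_closed_curve_def
proof (intro conjI)
  show "simple_path (\<lambda>t. (top_curve n e A t, 1::real))"
    using simple_path_top_curve unfolding simple_path_def path_def loop_free_def
    by (auto intro!: continuous_intros)
  show "pathfinish (\<lambda>t. (top_curve n e A t, 1::real)) = pathstart (\<lambda>t. (top_curve n e A t, 1))"
    using loop_graph_loop by (simp add: top_curve_def pathstart_def pathfinish_def)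
  have "(z, 1) \<in> surface n 2" if z: "z \<in> path_image (top_curve n e A)" for z
  proof (rule top_face_in_surface)
    note bounds = abs_arctan_less[unfolded abs_less_iff, of "poly (gap_poly A) x" for x]
    show "z \<in> cbox (Complex (-2) (-2)) (Complex (2 * real (n + 2)) 2)"
      using z e bounds[of "Re z"] bounds[of "2 * real n - 1 + e"] bounds[of "-1 - e"]
      unfolding path_image_top_curve by (auto simp: in_cbox_complex_iff)
    fix i
    \<comment> \<open>One coordinate suffices. Over a hole or a removed disc the graph has height at
      least 1/2 in absolute value; the straight sides are far enough from all centres.\<close>
    have "1/2 \<le> \<bar>Re z - 2 * real i\<bar> \<or> 1/2 \<le> \<bar>Im z\<bar>"
    proof -
      consider "Im z = -7/4 - e" | "Re z = 2 * real n - 1 + e"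
        | "Im z = arctan (poly (gap_poly A) (Re z))" | "Re z = -1 - e"
        using z unfolding path_image_top_curve by blast
      then show ?thesis
      proof cases
        case 1
        then show ?thesis
          using e by simp
      next
        case 2
        have "real i + 1 \<le> real n \<or> real n \<le> real i"
          by (cases "i < n") auto
        then show ?thesis
          using 2 e by linarith
      next
        case 3
        then show ?thesis
          using abs_poly_gap_poly_ge_1[of "Re z" i A] abs_arctan_ge_half by force
      next
        case 4
        then show ?thesis
          using e by simp
      qed
    qed
    then show "1/2 \<le> dist (centre i) z"
      using abs_Re_le_cmod[of "z - centre i"] abs_Im_le_cmod[of "z - centre i"]
      by (auto simp: dist_norm norm_minus_commute)
  qed
  then show "path_image (\<lambda>t. (top_curve n e A t, 1)) \<subseteq> surface n 2"
    by (auto simp: path_image_def)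
qed

text \<open>The centre has height 0, so it is below the graph exactly when \<open>arctan\<close> of
  the polynomial is positive there.\<close>

lemma winding_number_top_curve:
  assumes "i < n"
  shows "winding_number (top_curve n e A) (centre i) = (if 0 < poly (gap_poly A) (2 * real i) then 1 else 0)"
proof -
  have "real i + 1 \<le> real n"
    using assms by simp
  moreover have "poly (gap_poly A) (2 * real i) \<noteq> 0"
    using abs_poly_gap_poly_ge_1[of "2 * real i" i A] by auto
  ultimately show ?thesis
    unfolding top_curve_def using e
    by (subst winding_number_graph_loop) (use top_curve_graph in \<open>auto simp: zero_less_arctan_iff\<close>)
qed

end

section \<open>Counting intersection points\<close>

lemma path_image_top_curve_Int_subset:
  fixes n :: nat and A B :: "nat set"
  assumes "0 < e" "e < e'" "e' < 1/4"
  defines "l \<equiv> -1 - e" and "r \<equiv> 2 * real n - 1 + e"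
    and "p \<equiv> poly (gap_poly A)" and "q \<equiv> poly (gap_poly B)"
  shows "path_image (top_curve n e A) \<inter> path_image (top_curve n e' B) \<subseteq>
    (\<lambda>x. Complex x (arctan (q x))) ` {x \<in> {l..r}. p x = q x \<or> x \<in> {l, r} \<and> q x \<le> p x}"
proof
  fix z
  assume "z \<in> path_image (top_curve n e A) \<inter> path_image (top_curve n e' B)"
  then have A: "z \<in> path_image (top_curve n e A)" and B: "z \<in> path_image (top_curve n e' B)"
    by auto
  have "e < 1/4" "0 < e'"
    using assms by auto
  note images = path_image_top_curve[OF assms(1) \<open>e < 1/4\<close>] path_image_top_curve[OF \<open>0 < e'\<close> assms(3)]
  have lr: "l < r"
    using assms by (simp add: l_def r_def)
  have low: "-7/4 < arctan x" for x
    using abs_arctan_less[of x] by (simp add: abs_less_iff)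
  \<comment> \<open>The curve of \<open>A\<close> is strictly between the vertical sides and above
    the bottom of the curve of \<open>B\<close>, so it can meet only the graph of the
    latter.\<close>
  have "Re z \<in> {l..r}" "-7/4 - e \<le> Im z"
    using A lr low[of "p (Re z)"] assms(1) unfolding images l_def r_def p_def by auto
  then have z: "Im z = arctan (q (Re z))"
    using B assms(2) unfolding images l_def r_def q_def by auto
  then have "Im z \<noteq> -7/4 - e"
    using low[of "q (Re z)"] assms(1) by simp
  \<comment> \<open>On the inner curve the point is on the graph, or on a vertical side and thus not
    above its upper end, which gives \<open>q \<le> p\<close> there.\<close>
  then have "p (Re z) = q (Re z) \<or> Re z \<in> {l, r} \<and> q (Re z) \<le> p (Re z)"
    using A z unfolding images l_def r_def p_def q_def
    by (auto simp: arctan_eq_iff arctan_le_iff)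
  then show "z \<in> (\<lambda>x. Complex x (arctan (q x))) ` {x \<in> {l..r}. p x = q x \<or> x \<in> {l, r} \<and> q x \<le> p x}"
    using z \<open>Re z \<in> {l..r}\<close> by (intro image_eqI[of _ _ "Re z"]) (auto simp: complex_eq_iff)
qed

lemma card_path_image_top_curve_Int:
  assumes "0 < e" "e < e'" "e' < 1/4" "finite A" "finite B" "A \<noteq> B"
    and "card A = m" "card B = m" "2 \<le> m"
  shows "finite (path_image (top_curve n e A) \<inter> path_image (top_curve n e' B))"
    and "card (path_image (top_curve n e A) \<inter> path_image (top_curve n e' B)) \<le> 2 * (m - 1)"
proof -
  define l r where "l = -1 - e" and "r = 2 * real n - 1 + e"
  define p q where "p = poly (gap_poly A)" and "q = poly (gap_poly B)"
  define X where "X = {x \<in> {l..r}. p x = q x \<or> x \<in> {l, r} \<and> q x \<le> p x}"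
  define Z where "Z = {x. p x = q x}"
  have "l < r"
    using assms by (simp add: l_def r_def)
  have Z: "finite Z" "card Z < m"
    using card_gap_poly_agree[of A B m] assms by (auto simp: Z_def p_def q_def)
  have "X \<subseteq> insert l (insert r Z)"
    by (auto simp: X_def Z_def)
  then have "finite X"
    using Z(1) finite_subset by blast
  have "card X \<le> 2 * (m - 1)"
  proof (cases "m = 2")
    case False
    have "card X \<le> card (insert l (insert r Z))"
      using \<open>X \<subseteq> _\<close> Z(1) by (intro card_mono) auto
    also have "\<dots> \<le> card Z + 2"
      using card_insert_le_m1[of "card Z + 2" "insert r Z" l] card_insert_le_m1[of "card Z + 1" Z r]
      by simp
    finally show ?thesis
      using Z(2) False assms(9) by simp
  next
    case True
    \<comment> \<open>If \<open>q \<le> p\<close> at both ends, the affine difference has no zero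
      strictly between them; otherwise an end with \<open>p < q\<close> drops out, and
      \<open>Z\<close> has at most one point.\<close>
    have "\<exists>y W. X \<subseteq> insert y W \<and> finite W \<and> card W \<le> 1"
    proof (cases "q l \<le> p l \<and> q r \<le> p r")
      case ends: True
      have "X \<subseteq> {l, r}"
        using gap_poly_agree_ends[of A B l r] assms \<open>l < r\<close> ends True
        by (auto simp: X_def p_def q_def)
      then show ?thesis
        by (intro exI[of _ l] exI[of _ "{r}"]) auto
    next
      case False
      then have "X \<subseteq> insert l Z \<or> X \<subseteq> insert r Z"
        by (auto simp: X_def Z_def)
      then show ?thesis
        using Z True by (metis less_2_cases One_nat_def le_numeral_extra(4) less_imp_le zero_le_one)
    qed
    then obtain y W where "X \<subseteq> insert y W" "finite W" "card W \<le> 1"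
      by blast
    then have "card X \<le> card (insert y W)" "card (insert y W) \<le> 2"
      by (auto intro!: card_mono card_insert_le_m1)
    then show ?thesis
      using True by simp
  qed
  moreover have sub: "path_image (top_curve n e A) \<inter> path_image (top_curve n e' B) \<subseteq>
      (\<lambda>x. Complex x (arctan (q x))) ` X"
    using path_image_top_curve_Int_subset[OF assms(1-3), of n A B]
    unfolding X_def l_def r_def p_def q_def .
  moreover have "card ((\<lambda>x. Complex x (arctan (q x))) ` X) \<le> card X"
    using \<open>finite X\<close> by (rule card_image_le)
  ultimately show "card (path_image (top_curve n e A) \<inter> path_image (top_curve n e' B)) \<le> 2 * (m - 1)"
    using card_mono[OF _ sub] \<open>finite X\<close> by simp
  show "finite (path_image (top_curve n e A) \<inter> path_image (top_curve n e' B))"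
    using sub \<open>finite X\<close> finite_subset by blast
qed

section \<open>Assembling the system of curves\<close>

lemma homotopic_curves_refl:
  assumes "simple_closed_curve S c"
  shows "homotopic_curves S c c"
  using assms by (auto simp: simple_closed_curve_def homotopic_curves_def homotopic_loops_refl
      intro: simple_path_imp_path)

lemma geometric_intersection_le:
  assumes "simple_closed_curve S a" "simple_closed_curve S b"
  shows "geometric_intersection S a b \<le> ecard (path_image a \<inter> path_image b)"
  unfolding geometric_intersection_def
  using assms homotopic_curves_refl[of S] by (intro Inf_lower) blast

lemma curve_system_top_curves:
  assumes "2 \<le> m"
  shows "\<exists>C. curve_system (2 * (m - 1)) n 2 C \<and> finite C \<and> card C = n choose m"
proof -
  define F where "F = {A. A \<subseteq> {..<n} \<and> card A = m}"
  have F: "A \<subseteq> {..<n}" "finite A" "card A = m" if "A \<in> F" for A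
    using that finite_subset by (auto simp: F_def)
  have "finite F"
    unfolding F_def by simp
  then obtain idx :: "nat set \<Rightarrow> nat" where idx: "inj_on idx F"
    using finite_imp_inj_to_nat_seg by blast
  \<comment> \<open>Offsets below 1/4, distinct for distinct members of \<open>F\<close>, so that
    the U-shaped parts of any two curves are nested.\<close>
  define e where "e = (\<lambda>A. 1 / (5 + real (idx A)))"
  have e: "0 < e A" "e A < 1/4" for A
    by (auto simp: e_def field_simps)
  have e_inj: "e A \<noteq> e B" if "A \<in> F" "B \<in> F" "A \<noteq> B" for A B
    using inj_onD[OF idx _ that(1,2)] that(3) by (auto simp: e_def field_simps)
  let ?S = "surface n 2"
  define c where "c = (\<lambda>A t. (top_curve n (e A) A t, 1::real))"
  have simple: "simple_closed_curve ?S (c A)" for A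
    unfolding c_def using simple_closed_curve_top_curve e by blast
  have fst_c: "fst \<circ> c A = top_curve n (e A) A" for A
    by (auto simp: c_def)
  have wind: "winding_number (fst \<circ> c A) (centre i) \<noteq> 0 \<longleftrightarrow> 0 < poly (gap_poly A) (2 * real i)"
    if "i < n" for A i
    unfolding fst_c winding_number_top_curve[OF e that] by simp
  have essential: "essential n 2 (c A)" if A: "A \<in> F" for A
    using gap_poly_pos_somewhere[of A n] F[OF A] assms essentialI[of _ n "c A"] wind by metis
  have hom_eq: "A = B" if AB: "A \<in> F" "B \<in> F" and hom: "homotopic_curves ?S (c A) (c B)" for A B
    using winding_number_fst_homotopic_curves[OF hom] wind F(1)[OF AB(1)] F(1)[OF AB(2)]
    by (metis gap_poly_signs_inj)
  have "inj_on c F"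
    using hom_eq homotopic_curves_refl[OF simple] by (metis inj_onI)
  have inter: "geometric_intersection ?S (c A) (c B) \<le> enat (2 * (m - 1))"
    if AB: "A \<in> F" "B \<in> F" "A \<noteq> B" for A B
  proof -
    let ?P = "\<lambda>A. path_image (top_curve n (e A) A)"
    have "finite (?P A \<inter> ?P B) \<and> card (?P A \<inter> ?P B) \<le> 2 * (m - 1)"
    \<comment> \<open>The count takes the inner curve first, so the smaller offset decides the
      order.\<close>
    proof (cases "e A < e B")
      case True
      then show ?thesis
        using card_path_image_top_curve_Int[of "e A" "e B" A B m n] e F AB assms by auto
    next
      case False
      then have "e B < e A"
        using e_inj[OF AB] by simp
      then show ?thesis
        using card_path_image_top_curve_Int[of "e B" "e A" B A m n] e F AB assms
        by (auto simp: Int_commute)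
    qed
    moreover have "path_image (c A) \<inter> path_image (c B) = (\<lambda>z. (z, 1)) ` (?P A \<inter> ?P B)"
      by (auto simp: c_def path_image_def)
    ultimately have "ecard (path_image (c A) \<inter> path_image (c B)) \<le> enat (2 * (m - 1))"
      by (simp add: ecard_def card_image inj_on_def)
    then show ?thesis
      using geometric_intersection_le[OF simple simple] order_trans by blast
  qed
  have "curve_system (2 * (m - 1)) n 2 (c ` F)"
    unfolding curve_system_def using simple essential hom_eq inter by blast
  moreover have "card (c ` F) = n choose m"
    using \<open>inj_on c F\<close> n_subsets[of "{..<n}" m] by (simp add: card_image F_def)
  ultimately show ?thesis
    using \<open>finite F\<close> by blast
qed

theorem corollary1p6:
  fixes k g :: nat
  assumes "k \<ge> 2" and "g \<ge> 1"
  shows "max_curve_system k (g - 1) 2 \<ge> enat ((g - 1) choose (1 + k div 2))"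
proof -
  define m where "m = 1 + k div 2"
  \<comment> \<open>\<open>2 * (m - 1)\<close> is \<open>k\<close> rounded down to an even number; a
    system for this bound is also one for \<open>k\<close>.\<close>
  have "2 \<le> m" "2 * (m - 1) \<le> k"
    using assms(1) by (auto simp: m_def)
  then obtain C where C: "curve_system (2 * (m - 1)) (g - 1) 2 C" "finite C" "card C = (g - 1) choose m"
    using curve_system_top_curves by blast
  have "curve_system k (g - 1) 2 C"
    using C(1) \<open>2 * (m - 1) \<le> k\<close> unfolding curve_system_def
    by (meson enat_ord_simps(1) order_trans)
  then have "ecard C \<le> max_curve_system k (g - 1) 2"
    unfolding max_curve_system_def by (intro Sup_upper) blast
  then show ?thesis
    using C(2,3) by (simp add: ecard_def m_def)
qed

end
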